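(* Let $\mathcal O$ be the ring of integers of a number field and let $E\subseteq SL(2,\mathcal O)$ be the elementary matrix group. Let $K$ be a subgroup of $E$ of finite index, and suppose that the level of $K$ is $m$. Then $K$ is a congruence subgroup of $E$ if and only if $E(m)\subseteq K$.
   Context: Let $\{w_1=1,w_2,\dots,w_n\}$ be an integral basis of $\mathcal O$. The elementary matrix group $E$ is the subgroup of $SL(2,\mathcal O)$ generated by $T_i=\begin{pmatrix}1&w_i\\0&1\end{pmatrix}$ ($1\le i\le n$) and $S=\begin{pmatrix}0&1\\-1&0\end{pmatrix}$. For a nonzero ideal $\pi$ of $\mathcal O$, $E(\pi)=\{(a_{ij})\in E: a_{11}-1,\,a_{22}-1,\,a_{12},\,a_{21}\in\pi\}$; for a positive integer $m$, $E(m)$ means $E(m\mathcal O)$. A subgroup $K$ of $E$ is congruence if it contains $E(\pi)$ for some nonzero ideal $\pi\subseteq\mathcal O$. A finite index subgroup $K$ of $E$ has level $m$ if $m$ is the smallest positive integer such that the normal closure in $E$ of the subgroup generated by $\begin{pmatrix}1&mw_i\\0&1\end{pmatrix}$, $1\le i\le n$, is contained in $K$ (such an $m$ exists). *)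

theory Defs
  imports
    "HOL-Analysis.Determinants"
    "HOL-Algebra.Coset"
    "HOL-Algebra.Generated_Groups"
    "HOL-Algebra.Ideal"
    "HOL-Algebra.Embedded_Algebras"
    "HOL-Algebra.Algebraic_Closure_Type"
begin

text \<open>
  A number field is a subfield of an arbitrary field of characteristic 0 (given as a type) that has
  finite dimension over the rationals. A subset is used rather than the whole type, so that for
  instance all subfields of the complex numbers are covered at once.
\<close>

definition number_field :: "'a::field_char_0 set \<Rightarrow> bool" where
  "number_field F \<longleftrightarrow>
     subfield F ring_of_type_algebra \<and> ring.finite_dimension ring_of_type_algebra \<rat> F"

definition ring_of_integers :: "'a::field_char_0 set \<Rightarrow> 'a ring" where
  "ring_of_integers F = ring_of_type_algebra\<lparr>carrier := {x \<in> F. algebraic_int x}\<rparr>"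

text \<open>
  The uniqueness of the coefficients expresses linear independence over the integers. Families are
  indexed by \<open>{1..n}\<close>; the values of \<open>w\<close> outside this range are irrelevant.
\<close>

definition integral_basis :: "'a::field_char_0 set \<Rightarrow> nat \<Rightarrow> (nat \<Rightarrow> 'a) \<Rightarrow> bool" where
  "integral_basis F n w \<longleftrightarrow>
     w ` {1..n} \<subseteq> carrier (ring_of_integers F) \<and>
     (\<forall>x \<in> carrier (ring_of_integers F).
        \<exists>!c. c \<in> {1..n} \<rightarrow>\<^sub>E (UNIV :: int set) \<and> x = (\<Sum>i = 1..n. of_int (c i) * w i))"

definition SL2 :: "'a::comm_ring_1 ring \<Rightarrow> ('a^2^2) monoid" where
  "SL2 R = \<lparr>carrier = {A. (\<forall>i j. A $ i $ j \<in> carrier R) \<and> det A = 1},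
            monoid.mult = (**), one = mat 1\<rparr>"

definition T_mat :: "'a::comm_ring_1 \<Rightarrow> 'a^2^2" where
  "T_mat x = vector [vector [1, x], vector [0, 1]]"

definition S_mat :: "'a::comm_ring_1^2^2" where
  "S_mat = vector [vector [0, 1], vector [-1, 0]]"

definition elementary_group ::
    "'a::field_char_0 set \<Rightarrow> nat \<Rightarrow> (nat \<Rightarrow> 'a) \<Rightarrow> ('a^2^2) monoid" where
  "elementary_group F n w =
     (let G = SL2 (ring_of_integers F)
      in G\<lparr>carrier := generate G (insert S_mat ((\<lambda>i. T_mat (w i)) ` {1..n}))\<rparr>)"

definition principal_congruence ::
    "'a::field_char_0 set \<Rightarrow> nat \<Rightarrow> (nat \<Rightarrow> 'a) \<Rightarrow> 'a set \<Rightarrow> ('a^2^2) set" where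
  "principal_congruence F n w I =
     {A \<in> carrier (elementary_group F n w).
        A $ 1 $ 1 - 1 \<in> I \<and> A $ 2 $ 2 - 1 \<in> I \<and> A $ 1 $ 2 \<in> I \<and> A $ 2 $ 1 \<in> I}"

definition congruence_subgroup ::
    "'a::field_char_0 set \<Rightarrow> nat \<Rightarrow> (nat \<Rightarrow> 'a) \<Rightarrow> ('a^2^2) set \<Rightarrow> bool" where
  "congruence_subgroup F n w K \<longleftrightarrow>
     subgroup K (elementary_group F n w) \<and>
     (\<exists>I. ideal I (ring_of_integers F) \<and> I \<noteq> {0} \<and> principal_congruence F n w I \<subseteq> K)"

definition normal_closure :: "('g, 'm) monoid_scheme \<Rightarrow> 'g set \<Rightarrow> 'g set" where
  "normal_closure G H = (\<lambda>N. N \<lhd> G) hull H"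

definition level_closure ::
    "'a::field_char_0 set \<Rightarrow> nat \<Rightarrow> (nat \<Rightarrow> 'a) \<Rightarrow> nat \<Rightarrow> ('a^2^2) set" where
  "level_closure F n w m =
     (let E = elementary_group F n w
      in normal_closure E (generate E ((\<lambda>i. T_mat (of_nat m * w i)) ` {1..n})))"

definition finite_index :: "('g, 'm) monoid_scheme \<Rightarrow> 'g set \<Rightarrow> bool" where
  "finite_index G H \<longleftrightarrow> subgroup H G \<and> finite (rcosets\<^bsub>G\<^esub> H)"

definition has_level ::
    "'a::field_char_0 set \<Rightarrow> nat \<Rightarrow> (nat \<Rightarrow> 'a) \<Rightarrow> ('a^2^2) set \<Rightarrow> nat \<Rightarrow> bool" where
  "has_level F n w K m \<longleftrightarrow>
     m > 0 \<and> level_closure F n w m \<subseteq> K \<and>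
     (\<forall>k > 0. level_closure F n w k \<subseteq> K \<longrightarrow> m \<le> k)"

end

theory Submission
  imports Defs "Jordan_Normal_Form.Char_Poly"
begin

text \<open>
  Suppose \<open>K\<close> contains \<open>E(I)\<close> and the normal closure \<open>Q\<close> of the matrices \<open>T (m * w i)\<close>. A nonzero
  ideal contains a nonzero integer \<open>k\<close>, so it suffices to approximate each \<open>A \<in> E(m)\<close> modulo \<open>k\<close> by some
  \<open>B \<in> Q\<close>: then \<open>B\<inverse> A \<in> E(I) \<subseteq> K\<close>. Since \<open>\<O>/k\<O>\<close> is finite, it has stable range 1, and as the
  entry \<open>a\<close> of \<open>A\<close> is coprime to \<open>m\<close> and to its neighbour \<open>b\<close>, multiplying \<open>A\<close> by an elementary matrix of
  \<open>Q\<close> makes the upper left entry a unit \<open>u = 1 + z\<close> modulo \<open>k\<close> with \<open>z \<in> m\<O>\<close>. A conjugate of an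
  elementary matrix in \<open>Q\<close> has the same upper left entry, and two matrices of determinant 1 sharing
  a unit there and congruent to 1 modulo \<open>m\<close> differ by elementary matrices with off-diagonal
  entries in \<open>m\<O>\<close>.
\<close>

no_notation vec_index (infixl "$" 100)

subsection \<open>Sums and products of algebraic integers\<close>

text \<open>Spanned by a family rather than a set, because distinct exponent pairs may give equal
  monomials \<open>x ^ i * y ^ j\<close>.\<close>

definition int_span :: "('i \<Rightarrow> 'a::comm_ring_1) \<Rightarrow> 'i set \<Rightarrow> 'a set" where
  "int_span v I = {x. \<exists>c. x = (\<Sum>i\<in>I. of_int (c i) * v i)}"

lemma int_spanI: "x = (\<Sum>i\<in>I. of_int (c i) * v i) \<Longrightarrow> x \<in> int_span v I"
  unfolding int_span_def by blast

lemma int_span_base: "finite I \<Longrightarrow> i \<in> I \<Longrightarrow> v i \<in> int_span v I"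
  unfolding int_span_def
  by (intro CollectI exI[of _ "\<lambda>j. if j = i then 1 else 0"])
     (simp add: if_distrib[where f = of_int] if_distrib[where f = "\<lambda>x. x * _"] sum.delta cong: if_cong)

lemma int_span_add: "x \<in> int_span v I \<Longrightarrow> y \<in> int_span v I \<Longrightarrow> x + y \<in> int_span v I"
proof -
  assume "x \<in> int_span v I" "y \<in> int_span v I"
  then obtain c d where "x = (\<Sum>i\<in>I. of_int (c i) * v i)" "y = (\<Sum>i\<in>I. of_int (d i) * v i)"
    unfolding int_span_def by blast
  then have "x + y = (\<Sum>i\<in>I. of_int (c i + d i) * v i)"
    by (simp add: sum.distrib distrib_right)
  then show ?thesis
    by (rule int_spanI)
qed

lemma int_span_of_int_mult: "x \<in> int_span v I \<Longrightarrow> of_int k * x \<in> int_span v I"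
proof -
  assume "x \<in> int_span v I"
  then obtain c where "x = (\<Sum>i\<in>I. of_int (c i) * v i)"
    unfolding int_span_def by blast
  then have "of_int k * x = (\<Sum>i\<in>I. of_int (k * c i) * v i)"
    by (simp add: sum_distrib_left mult.assoc)
  then show ?thesis
    by (rule int_spanI)
qed

lemma int_span_0: "0 \<in> int_span v I"
  unfolding int_span_def by (intro CollectI exI[of _ "\<lambda>_. 0"]) simp

lemma int_span_sum: "(\<And>j. j \<in> J \<Longrightarrow> f j \<in> int_span v I) \<Longrightarrow> sum f J \<in> int_span v I"
  by (induction J rule: infinite_finite_induct) (auto intro: int_span_0 int_span_add)

lemma int_span_mult:
  assumes "\<And>i. i \<in> I \<Longrightarrow> x * v i \<in> int_span v I" and "y \<in> int_span v I"
  shows "x * y \<in> int_span v I"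
proof -
  obtain c where "y = (\<Sum>i\<in>I. of_int (c i) * v i)"
    using assms(2) unfolding int_span_def by blast
  then have "x * y = (\<Sum>i\<in>I. of_int (c i) * (x * v i))"
    by (simp add: sum_distrib_left mult.left_commute)
  then show ?thesis
    using assms(1) by (auto intro: int_span_sum int_span_of_int_mult)
qed

text \<open>Determinant trick: multiplication by \<open>x\<close> acts on the generators through an
  integer matrix, whose characteristic polynomial is monic. The generators form an eigenvector for
  \<open>x\<close>, nonzero because \<open>v i0\<close> is.\<close>

lemma algebraic_int_if_stable_int_span:
  fixes x :: "'a::field_char_0"
  assumes "finite I" "i0 \<in> I" "v i0 \<noteq> 0"
    and stable: "\<And>i. i \<in> I \<Longrightarrow> x * v i \<in> int_span v I"
  shows "algebraic_int x"
proof -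
  obtain c where c: "\<And>i. i \<in> I \<Longrightarrow> x * v i = (\<Sum>j\<in>I. of_int (c i j) * v j)"
    using stable unfolding int_span_def mem_Collect_eq by metis
  define d where "d = card I"
  \<comment> \<open>The index set is enumerated because \<open>mat\<close> and \<open>vec\<close>
    are indexed by initial segments of the naturals.\<close>
  obtain h where h: "bij_betw h {..<d} I"
    using ex_bij_betw_nat_finite[OF \<open>finite I\<close>] unfolding d_def lessThan_atLeast0 by blast
  define A :: "int mat" where "A = Matrix.mat d d (\<lambda>(i, j). c (h i) (h j))"
  define e where "e = Matrix.vec d (\<lambda>i. v (h i))"
  let ?A = "map_mat of_int A :: 'a mat"
  have A: "A \<in> carrier_mat d d" "?A \<in> carrier_mat d d"
    by (auto simp: A_def)
  obtain k where k: "k < d" "h k = i0"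
    using h \<open>i0 \<in> I\<close> unfolding bij_betw_def by auto
  have "e \<noteq> 0\<^sub>v d"
  proof
    assume "e = 0\<^sub>v d"
    then have "vec_index e k = 0"
      using k by simp
    then show False
      using k assms(3) by (simp add: e_def)
  qed
  moreover have "?A *\<^sub>v e = x \<cdot>\<^sub>v e"
  proof (rule eq_vecI)
    fix i assume "i < dim_vec (x \<cdot>\<^sub>v e)"
    then have i: "i < d" by (simp add: e_def)
    have "vec_index (?A *\<^sub>v e) i = (\<Sum>j<d. of_int (c (h i) (h j)) * v (h j))"
      using i by (simp add: A_def e_def scalar_prod_def atLeast0LessThan)
    also have "\<dots> = (\<Sum>j\<in>I. of_int (c (h i) j) * v j)"
      by (rule sum.reindex_bij_betw[OF h])
    also have "\<dots> = x * v (h i)"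
      using c h i unfolding bij_betw_def by force
    finally show "vec_index (?A *\<^sub>v e) i = vec_index (x \<cdot>\<^sub>v e) i"
      using i by (simp add: e_def)
  qed (simp add: A_def e_def)
  ultimately have "eigenvalue ?A x"
    unfolding eigenvalue_def eigenvector_def
    by (intro exI[of _ e]) (auto simp: A_def e_def)
  then have "poly (map_poly of_int (char_poly A)) x = 0"
    using eigenvalue_root_char_poly[OF A(2)] of_int_hom.char_poly_hom[OF A(1), where 'a = 'a] by simp
  moreover have "lead_coeff (char_poly A) = 1"
    using degree_monic_char_poly[OF A(1)] by simp
  ultimately show ?thesis
    unfolding algebraic_int_altdef_ipoly by blast
qed

text \<open>A monic relation solved for its leading term. The degree is positive because the
  constant polynomial 1 has no root.\<close>

lemma algebraic_int_power_relation:
  fixes x :: "'a::field_char_0"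
  assumes "algebraic_int x"
  obtains r c where "r > 0" "x ^ r = (\<Sum>k<r. of_int (c k) * x ^ k)"
proof -
  obtain p where p: "poly (map_poly of_int p) x = 0" "lead_coeff p = 1"
    using assms unfolding algebraic_int_altdef_ipoly by blast
  have sum: "(\<Sum>k\<le>degree p. of_int (coeff p k) * x ^ k) = 0"
    using p(1) by (simp add: poly_altdef of_int_hom.coeff_map_poly_hom degree_map_poly)
  have "degree p > 0"
  proof (rule ccontr)
    assume "\<not> degree p > 0"
    then show False using sum p(2) by simp
  qed
  moreover have "x ^ degree p = (\<Sum>k<degree p. of_int (- coeff p k) * x ^ k)"
  proof -
    have "(\<Sum>k<degree p. of_int (coeff p k) * x ^ k) + x ^ degree p = 0"
      using sum p(2) by (simp add: lessThan_Suc_atMost[symmetric])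
    then have "x ^ degree p = - (\<Sum>k<degree p. of_int (coeff p k) * x ^ k)"
      by (simp add: eq_neg_iff_add_eq_0 add.commute)
    then show ?thesis
      by (simp add: sum_negf)
  qed
  ultimately show ?thesis
    by (rule that)
qed

text \<open>
  Both claims hold because the monomials \<open>x ^ i * y ^ j\<close> of bounded degree span a \<open>\<int>\<close>-module that is
  stable under \<open>x\<close> and \<open>y\<close>.
\<close>

lemma
  fixes x y :: "'a::field_char_0"
  assumes x: "algebraic_int x" and y: "algebraic_int y"
  shows algebraic_int_add: "algebraic_int (x + y)"
    and algebraic_int_mult: "algebraic_int (x * y)"
proof -
  obtain r c where r: "r > 0" "x ^ r = (\<Sum>k<r. of_int (c k) * x ^ k)"
    using algebraic_int_power_relation[OF x] by blast
  obtain s d where s: "s > 0" "y ^ s = (\<Sum>k<s. of_int (d k) * y ^ k)"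
    using algebraic_int_power_relation[OF y] by blast
  define I where "I = {..<r} \<times> {..<s}"
  define v where "v = (\<lambda>(i, j). x ^ i * y ^ j)"
  have fin: "finite I" and zero: "(0, 0) \<in> I" "v (0, 0) \<noteq> 0"
    using r(1) s(1) by (auto simp: I_def v_def)
  have base: "x ^ i * y ^ j \<in> int_span v I" if "i < r" "j < s" for i j
    using int_span_base[OF fin, of "(i, j)" v] that by (simp add: I_def v_def)
  have X: "x * v i \<in> int_span v I" if i: "i \<in> I" for i
  proof -
    obtain a b where ab: "i = (a, b)" "a < r" "b < s"
      using i by (auto simp: I_def)
    have "x ^ Suc a * y ^ b \<in> int_span v I"
    proof (cases "Suc a < r")
      case True
      then show ?thesis using base ab by blast
    next
      case False
      then have "Suc a = r" using ab by simp
      then have "x ^ Suc a * y ^ b = (\<Sum>k<r. of_int (c k) * (x ^ k * y ^ b))"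
        using r(2) by (simp only: sum_distrib_right mult.assoc)
      then show ?thesis
        using base ab by (auto intro: int_span_sum int_span_of_int_mult)
    qed
    then show ?thesis using ab by (simp add: v_def mult.assoc)
  qed
  have Y: "y * v i \<in> int_span v I" if i: "i \<in> I" for i
  proof -
    obtain a b where ab: "i = (a, b)" "a < r" "b < s"
      using i by (auto simp: I_def)
    have "x ^ a * y ^ Suc b \<in> int_span v I"
    proof (cases "Suc b < s")
      case True
      then show ?thesis using base ab by blast
    next
      case False
      then have "Suc b = s" using ab by simp
      then have "x ^ a * y ^ Suc b = (\<Sum>k<s. of_int (d k) * (x ^ a * y ^ k))"
        using s(2) by (simp only: sum_distrib_left mult.left_commute)
      then show ?thesis
        using base ab by (auto intro: int_span_sum int_span_of_int_mult)
    qed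
    then show ?thesis using ab by (simp add: v_def mult.left_commute)
  qed
  show "algebraic_int (x + y)"
    by (rule algebraic_int_if_stable_int_span[where v = v, OF fin zero])
       (simp add: distrib_right X Y int_span_add)
  show "algebraic_int (x * y)"
    by (rule algebraic_int_if_stable_int_span[where v = v, OF fin zero])
       (simp add: mult.assoc int_span_mult X Y)
qed

text \<open>
  For \<open>p\<close> of minimal degree the constant term is nonzero, as \<open>x\<close> could be divided out otherwise.
\<close>

lemma algebraic_int_dvd_int:
  fixes x :: "'a::field_char_0"
  assumes "algebraic_int x" "x \<noteq> 0"
  obtains q :: "int poly" and k :: int where "k \<noteq> 0" "of_int k = poly (map_poly of_int q) x * x"
proof -
  let ?P = "\<lambda>p :: int poly. poly (map_poly of_int p) x = 0 \<and> lead_coeff p = 1"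
  obtain p where p: "?P p" and min: "\<And>q. ?P q \<Longrightarrow> degree p \<le> degree q"
  proof -
    obtain p where "?P p"
      using assms(1) unfolding algebraic_int_altdef_ipoly by blast
    from ex_has_least_nat[of ?P, OF this, of degree] show ?thesis
      using that by blast
  qed
  obtain c q where pc: "p = pCons c q"
    by (cases p) auto
  have root: "of_int c + x * poly (map_poly of_int q) x = 0"
    using p by (simp add: pc of_int_hom.map_poly_pCons_hom)
  have "q \<noteq> 0"
    using p root by (auto simp: pc)
  have "c \<noteq> 0"
  proof
    assume "c = 0"
    then have "?P q"
      using p root \<open>q \<noteq> 0\<close> assms(2) by (simp add: pc)
    then show False
      using min[of q] \<open>q \<noteq> 0\<close> by (simp add: pc)
  qed
  moreover have "of_int (- c) = poly (map_poly of_int q) x * x"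
    using root by (simp add: mult.commute add_eq_0_iff)
  ultimately show ?thesis
    using that[of "- c" q] by simp
qed

subsection \<open>Finite quotients have stable range 1\<close>

text \<open>Congruences are written as differences in \<open>J\<close>, so no quotient ring is
  formed. Finiteness enters only through its pigeonhole consequence
  \<open>power_collision\<close>.\<close>

locale finite_quotient =
  fixes R J :: "'a::comm_ring_1 set"
  assumes one: "1 \<in> R"
    and diff: "x \<in> R \<Longrightarrow> y \<in> R \<Longrightarrow> x - y \<in> R"
    and mult: "x \<in> R \<Longrightarrow> y \<in> R \<Longrightarrow> x * y \<in> R"
    and ideal_diff: "x \<in> J \<Longrightarrow> y \<in> J \<Longrightarrow> x - y \<in> J"
    and ideal_mult: "r \<in> R \<Longrightarrow> x \<in> J \<Longrightarrow> r * x \<in> J"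
    and power_collision: "x \<in> R \<Longrightarrow> \<exists>i j. i < j \<and> x ^ i - x ^ j \<in> J"
begin

lemma zero: "0 \<in> R"
  using diff[OF one one] by simp

lemma neg: "x \<in> R \<Longrightarrow> - x \<in> R"
  using diff[OF zero, of x] by simp

lemma add: "x \<in> R \<Longrightarrow> y \<in> R \<Longrightarrow> x + y \<in> R"
  using diff[OF _ neg, of x y] by simp

lemma power: "x \<in> R \<Longrightarrow> x ^ i \<in> R"
  by (induction i) (auto intro: one mult)

lemma ideal_zero: "0 \<in> J"
proof -
  \<comment> \<open>A collision among the powers of 1 shows that \<open>J\<close> is nonempty and
    contains 0.\<close>
  obtain i j where "1 ^ i - (1 :: 'a) ^ j \<in> J"
    using power_collision[OF one] by blast
  then show ?thesis by simp
qed

lemma ideal_add: "x \<in> J \<Longrightarrow> y \<in> J \<Longrightarrow> x + y \<in> J"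
  using ideal_diff[OF _ ideal_diff[OF ideal_zero], of x y] by simp

lemma ideal_neg: "x \<in> J \<Longrightarrow> - x \<in> J"
  using ideal_diff[OF ideal_zero, of x] by simp

lemma ideal_mult_right: "x \<in> J \<Longrightarrow> r \<in> R \<Longrightarrow> x * r \<in> J"
  using ideal_mult[of r x] by (simp add: mult.commute)

text \<open>Two powers of \<open>u\<close> agree modulo \<open>J\<close>; cancelling the smaller one
  gives \<open>u ^ Suc p = 1\<close>, so \<open>u ^ p\<close> is an inverse.\<close>

lemma unit_if_nonzerodivisor:
  assumes u: "u \<in> R" and inj: "\<And>r. r \<in> R \<Longrightarrow> u * r \<in> J \<Longrightarrow> r \<in> J"
  shows "\<exists>s\<in>R. u * s - 1 \<in> J"
proof -
  obtain i j where ij: "i < j" "u ^ i - u ^ j \<in> J"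
    using power_collision[OF u] by blast
  define p where "p = j - i - 1"
  have j: "j = i + Suc p"
    using ij(1) by (simp add: p_def)
  have cancel: "u ^ i * r \<in> J \<Longrightarrow> r \<in> R \<Longrightarrow> r \<in> J" for i r
  proof (induction i)
    case (Suc i)
    then show ?case
      using inj[of "u ^ i * r"] power[OF u, of i] by (simp add: mult mult.assoc)
  qed simp
  have "u ^ i * (1 - u ^ Suc p) \<in> J"
    using ij(2) by (simp add: j power_add algebra_simps)
  then have "1 - u ^ Suc p \<in> J"
    using cancel power[OF u] one diff by blast
  then have "u * u ^ p - 1 \<in> J"
    using ideal_neg by fastforce
  then show ?thesis
    using power[OF u] by blast
qed

text \<open>From exponent \<open>i\<close> on, the powers of \<open>a\<close> have period
  \<open>p\<close> modulo \<open>J\<close>. A positive multiple of \<open>p\<close> that is at least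
  \<open>i\<close> therefore yields an idempotent.\<close>

lemma power_idempotent:
  assumes a: "a \<in> R"
  shows "\<exists>k>0. a ^ k - a ^ (2 * k) \<in> J"
proof -
  obtain i j where ij: "i < j" "a ^ i - a ^ j \<in> J"
    using power_collision[OF a] by blast
  define p where "p = j - i"
  have j: "j = i + p" "p > 0"
    using ij(1) by (auto simp: p_def)
  have step: "a ^ l - a ^ (l + p) \<in> J" if "l \<ge> i" for l
  proof -
    have "a ^ l - a ^ (l + p) = a ^ (l - i) * (a ^ i - a ^ j)"
      using that by (simp add: j algebra_simps flip: power_add)
    then show ?thesis
      using ideal_mult[OF power[OF a] ij(2)] by simp
  qed
  have steps: "a ^ l - a ^ (l + q * p) \<in> J" if "l \<ge> i" for l q
  proof (induction q)
    case 0
    then show ?case by (simp add: ideal_zero)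
  next
    case (Suc q)
    then show ?case
      using ideal_add[OF Suc step[of "l + q * p"]] that by (simp add: add.assoc add.commute[of p])
  qed
  \<comment> \<open>This is the exponent \<open>k\<close>. The successor keeps it positive when
    \<open>i = 0\<close>, and \<open>Suc i\<close> further periods double it.\<close>
  have "i \<le> Suc i * p"
    using j(2) by (cases p) auto
  from steps[OF this, of "Suc i"] show ?thesis
    unfolding mult_2[symmetric] using j(2) by (intro exI[of _ "Suc i * p"]) simp
qed

text \<open>
  Here \<open>t\<close> is the complement of the idempotent generated by \<open>a\<close>: where \<open>a\<close> is invertible, \<open>a + t * b\<close>
  is \<open>a\<close>, and where \<open>a\<close> is nilpotent, \<open>b\<close> is invertible.
\<close>

lemma stable_range:
  assumes R: "a \<in> R" "b \<in> R" "x \<in> R" "y \<in> R" and unimodular: "a * x + b * y - 1 \<in> J"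
  shows "\<exists>t\<in>R. \<exists>s\<in>R. (a + t * b) * s - 1 \<in> J"
proof -
  obtain k where k: "k > 0" "a ^ k - a ^ (2 * k) \<in> J"
    using power_idempotent[OF R(1)] by blast
  define e where "e = a ^ k"
  have e: "e \<in> R" "e - e * e \<in> J"
    using k(2) power[OF R(1)] by (auto simp: e_def mult_2 power_add)
  have t: "1 - e \<in> R"
    using e one diff by blast
  have "r \<in> J" if r: "r \<in> R" and ur: "(a + (1 - e) * b) * r \<in> J" for r
  proof -
    \<comment> \<open>Multiplying by the idempotent \<open>e\<close> removes the \<open>b\<close>
      term and leaves \<open>a * e * r\<close>; a further factor \<open>a ^ (k - 1)\<close> turns
      \<open>a\<close> into \<open>e\<close>.\<close>
    have "e * ((a + (1 - e) * b) * r) - (e - e * e) * (b * r) \<in> J"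
      using ideal_diff ideal_mult[OF e(1) ur] ideal_mult_right[OF e(2) mult[OF R(2) r]] by blast
    moreover have "e * ((a + (1 - e) * b) * r) - (e - e * e) * (b * r) = a * e * r"
      by (simp add: algebra_simps)
    ultimately have "a ^ (k - 1) * (a * e * r) \<in> J"
      using ideal_mult power[OF R(1)] by simp
    moreover have "a ^ (k - 1) * (a * e * r) = e * e * r"
      using k(1) by (cases k) (simp_all add: e_def mult_ac)
    ultimately have "e * e * r + (e - e * e) * r \<in> J"
      using ideal_add ideal_mult_right[OF e(2) r] by simp
    then have er: "e * r \<in> J"
      by (simp add: algebra_simps)
    have "(a + (1 - e) * b) * r + b * (e * r) \<in> J"
      using ideal_add ideal_mult ur er R(2) by blast
    then have ab: "(a + b) * r \<in> J"
      by (simp add: algebra_simps)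
    \<comment> \<open>Descent on the exponent, started below from \<open>e = a ^ k\<close>: both
      \<open>a\<close> and \<open>b\<close> annihilate \<open>s = a ^ i * r\<close> modulo
      \<open>J\<close>, hence so does \<open>a * x + b * y\<close>, which is 1 modulo
      \<open>J\<close>.\<close>
    have "a ^ i * r \<in> J \<Longrightarrow> r \<in> J" for i
    proof (induction i)
      case (Suc i)
      define s where "s = a ^ i * r"
      have s: "s \<in> R" "a * s \<in> J"
        using Suc.prems mult[OF power[OF R(1)] r] by (auto simp: s_def mult.assoc)
      have "a ^ i * ((a + b) * r) - a * s \<in> J"
        using ideal_diff ideal_mult power[OF R(1)] ab s(2) by blast
      then have bs: "b * s \<in> J"
        by (simp add: s_def algebra_simps)
      have "x * (a * s) + y * (b * s) - (a * x + b * y - 1) * s \<in> J"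
        by (intro ideal_add ideal_diff ideal_mult ideal_mult_right R(3,4) s bs unimodular)
      then have "s \<in> J"
        by (simp add: algebra_simps)
      then show ?case
        using Suc.IH by (simp add: s_def)
    qed simp
    then show ?thesis
      using er unfolding e_def by blast
  qed
  then show ?thesis
    using unit_if_nonzerodivisor[of "a + (1 - e) * b"] t R add mult by blast
qed

end

subsection \<open>Two by two matrices and normal closures\<close>

text \<open>With explicit entries, matrix identities reduce to ring identities.\<close>

definition mat2 :: "'a \<Rightarrow> 'a \<Rightarrow> 'a \<Rightarrow> 'a \<Rightarrow> 'a::zero^2^2" where
  "mat2 a b c d = vector [vector [a, b], vector [c, d]]"

lemma mat2_nth [simp]:
  "mat2 a b c d $ 1 $ 1 = a" "mat2 a b c d $ 1 $ 2 = b"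
  "mat2 a b c d $ 2 $ 1 = c" "mat2 a b c d $ 2 $ 2 = d"
  by (simp_all add: mat2_def)

lemma mat2_cases: obtains a b c d where "A = mat2 a b c d"
proof -
  have "A = mat2 (A $ 1 $ 1) (A $ 1 $ 2) (A $ 2 $ 1) (A $ 2 $ 2)"
    by (simp add: Finite_Cartesian_Product.vec_eq_iff forall_2)
  then show ?thesis by (rule that)
qed

lemma mat2_mult:
  "mat2 a b c d ** mat2 a' b' c' d' =
     mat2 (a * a' + b * c') (a * b' + b * d') (c * a' + d * c') (c * b' + d * d')"
  by (simp add: Finite_Cartesian_Product.vec_eq_iff forall_2 matrix_matrix_mult_def sum_2)

lemma mat2_one: "Finite_Cartesian_Product.mat 1 = mat2 1 0 0 1"
  by (simp add: Finite_Cartesian_Product.vec_eq_iff forall_2 Finite_Cartesian_Product.mat_def)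

lemma mat2_det: "Determinants.det (mat2 a b c d) = a * d - b * c"
  by (simp add: det_2)

lemma T_mat_mat2: "T_mat x = mat2 1 x 0 1"
  by (simp add: T_mat_def mat2_def)

lemma S_mat_mat2: "S_mat = mat2 0 1 (- 1) 0"
  by (simp add: S_mat_def mat2_def)

lemma mat2_in_SL2_iff:
  "mat2 a b c d \<in> carrier (SL2 R) \<longleftrightarrow>
     {a, b, c, d} \<subseteq> carrier R \<and> a * d - b * c = 1"
  by (auto simp: SL2_def forall_2 mat2_det)

lemma SL2_simps: "monoid.mult (SL2 R) = (**)" "one (SL2 R) = mat2 1 0 0 1"
  by (simp_all add: SL2_def mat2_one)

lemma group_SL2:
  assumes one: "1 \<in> carrier R"
    and diff: "\<And>x y. x \<in> carrier R \<Longrightarrow> y \<in> carrier R \<Longrightarrow> x - y \<in> carrier R"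
    and mult: "\<And>x y. x \<in> carrier R \<Longrightarrow> y \<in> carrier R \<Longrightarrow> x * y \<in> carrier R"
  shows "group (SL2 R)"
proof (rule groupI)
  have zero: "0 \<in> carrier R"
    using diff[OF one one] by simp
  have neg: "- x \<in> carrier R" if "x \<in> carrier R" for x
    using diff[OF zero that] by simp
  have add: "x + y \<in> carrier R" if "x \<in> carrier R" "y \<in> carrier R" for x y
    using diff[OF that(1) neg[OF that(2)]] by simp
  show "\<one>\<^bsub>SL2 R\<^esub> \<in> carrier (SL2 R)"
    using zero one by (simp add: SL2_simps mat2_in_SL2_iff)
  fix A assume A: "A \<in> carrier (SL2 R)"
  obtain a b c d where A': "A = mat2 a b c d"
    by (rule mat2_cases)
  \<comment> \<open>The adjugate, which is the inverse since the determinant is 1.\<close>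
  have "mat2 d (- b) (- c) a \<in> carrier (SL2 R)"
    using A neg by (simp add: A' mat2_in_SL2_iff algebra_simps)
  moreover have "mat2 d (- b) (- c) a \<otimes>\<^bsub>SL2 R\<^esub> A = \<one>\<^bsub>SL2 R\<^esub>"
    using A by (simp add: A' mat2_in_SL2_iff SL2_simps mat2_mult algebra_simps)
  ultimately show "\<exists>B\<in>carrier (SL2 R). B \<otimes>\<^bsub>SL2 R\<^esub> A = \<one>\<^bsub>SL2 R\<^esub>"
    by blast
  show "\<one>\<^bsub>SL2 R\<^esub> \<otimes>\<^bsub>SL2 R\<^esub> A = A"
    by (simp add: A' SL2_simps mat2_mult)
  fix B assume B: "B \<in> carrier (SL2 R)"
  show "A \<otimes>\<^bsub>SL2 R\<^esub> B \<in> carrier (SL2 R)"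
  proof -
    obtain a' b' c' d' where B': "B = mat2 a' b' c' d'"
      by (rule mat2_cases)
    have "Determinants.det (A ** B) = 1"
      using A B by (simp add: SL2_def det_mul)
    then show ?thesis
      using A B add mult
      by (simp add: A' B' SL2_simps mat2_mult mat2_in_SL2_iff mat2_det)
  qed
  fix C
  show "A \<otimes>\<^bsub>SL2 R\<^esub> B \<otimes>\<^bsub>SL2 R\<^esub> C = A \<otimes>\<^bsub>SL2 R\<^esub> (B \<otimes>\<^bsub>SL2 R\<^esub> C)"
    by (simp add: SL2_simps matrix_mul_assoc)
qed

context
  fixes G :: "('g, 'm) monoid_scheme" and H :: "'g set"
begin

text \<open>The hull is the intersection of all normal subgroups containing \<open>H\<close>, so
  each closure property below is checked inside one such subgroup at a time.\<close>

lemma normal_closureI: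
  "(\<And>N. N \<lhd> G \<Longrightarrow> H \<subseteq> N \<Longrightarrow> x \<in> N) \<Longrightarrow> x \<in> normal_closure G H"
  by (auto simp: normal_closure_def hull_def)

lemma normal_closureD:
  "x \<in> normal_closure G H \<Longrightarrow> N \<lhd> G \<Longrightarrow> H \<subseteq> N \<Longrightarrow> x \<in> N"
  by (auto simp: normal_closure_def hull_def)

lemma normal_closure_base: "x \<in> H \<Longrightarrow> x \<in> normal_closure G H"
  by (auto intro: normal_closureI)

lemma normal_closure_mult:
  "x \<in> normal_closure G H \<Longrightarrow> y \<in> normal_closure G H \<Longrightarrow> x \<otimes>\<^bsub>G\<^esub> y \<in> normal_closure G H"
  by (rule normal_closureI)
     (meson normal_closureD normal_imp_subgroup subgroup.m_closed)

lemma normal_closure_one: "\<one>\<^bsub>G\<^esub> \<in> normal_closure G H"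
  by (rule normal_closureI) (meson normal_imp_subgroup subgroup.one_closed)

lemma normal_closure_inv:
  "x \<in> normal_closure G H \<Longrightarrow> inv\<^bsub>G\<^esub> x \<in> normal_closure G H"
  by (rule normal_closureI)
     (meson normal_closureD normal_imp_subgroup subgroup.m_inv_closed)

lemma normal_closure_conj:
  "g \<in> carrier G \<Longrightarrow> x \<in> normal_closure G H \<Longrightarrow> g \<otimes>\<^bsub>G\<^esub> x \<otimes>\<^bsub>G\<^esub> inv\<^bsub>G\<^esub> g \<in> normal_closure G H"
  by (rule normal_closureI) (meson normal_closureD normal.inv_op_closed2)

end

subsection \<open>The elementary group over a ring of integers\<close>

lemma ring_of_integers_simps:
  "carrier (ring_of_integers F) = {x \<in> F. algebraic_int x}"
  "monoid.mult (ring_of_integers F) = (*)" "one (ring_of_integers F) = 1"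
  "zero (ring_of_integers F) = 0" "add (ring_of_integers F) = (+)"
  by (simp_all add: ring_of_integers_def ring_of_type_algebra_def)

lemma a_inv_ring_of_type_algebra: "\<ominus>\<^bsub>ring_of_type_algebra\<^esub> x = - (x :: 'a::comm_ring_1)"
proof -
  interpret ring "ring_of_type_algebra :: 'a ring"
    by (rule ring_from_type_algebra)
  show ?thesis
    by (rule minus_equality) (simp_all add: ring_of_type_algebra_def)
qed

lemma ring_of_type_algebra_simps:
  "carrier ring_of_type_algebra = UNIV" "monoid.mult ring_of_type_algebra = (*)"
  "one ring_of_type_algebra = 1" "zero ring_of_type_algebra = 0" "add ring_of_type_algebra = (+)"
  "\<ominus>\<^bsub>ring_of_type_algebra\<^esub> x = - (x :: 'a::comm_ring_1)"
  by (simp_all add: a_inv_ring_of_type_algebra) (simp_all add: ring_of_type_algebra_def)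

lemma subring_ring_of_integers:
  assumes "number_field F"
  shows "subring (carrier (ring_of_integers F)) ring_of_type_algebra"
proof -
  interpret T: ring "ring_of_type_algebra :: 'a ring"
    by (rule ring_from_type_algebra)
  have "subring F ring_of_type_algebra"
    using assms unfolding number_field_def
    by (meson subfield.axioms(1) subdomain.axioms(1) subcring.axioms(1))
  note F = subringE[OF this]
  show ?thesis
    by (rule T.subringI; use F(3,5,6,7) in
        \<open>simp add: ring_of_integers_simps ring_of_type_algebra_simps algebraic_int_add algebraic_int_mult\<close>)
qed

lemma cring_ring_of_integers:
  assumes "number_field F"
  shows "cring (ring_of_integers F)"
proof -
  have "ring (ring_of_type_algebra :: 'a ring)"
    by (rule ring_from_type_algebra)
  then have "ring (ring_of_type_algebra\<lparr>carrier := carrier (ring_of_integers F)\<rparr>)"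
    by (rule ring.subring_is_ring) (rule subring_ring_of_integers[OF assms])
  then have "ring (ring_of_integers F)"
    by (simp add: ring_of_integers_def)
  then show ?thesis
    by (intro cring.intro comm_monoid.intro comm_monoid_axioms.intro)
       (simp_all add: ring_of_integers_simps ring.is_monoid mult.commute)
qed

locale number_field_basis =
  fixes F :: "'a::field_char_0 set" and n :: nat and w :: "nat \<Rightarrow> 'a"
  assumes number_field: "number_field F" and basis: "integral_basis F n w" and w1: "w 1 = 1"
begin

abbreviation integers :: "'a set" (\<open>\<O>\<close>) where "\<O> \<equiv> carrier (ring_of_integers F)"
abbreviation E :: "('a^2^2) monoid" where "E \<equiv> elementary_group F n w"

lemmas O_subring = subringE[OF subring_ring_of_integers[OF number_field]]

lemma O_one: "1 \<in> \<O>" and O_zero: "0 \<in> \<O>"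
  and O_neg: "x \<in> \<O> \<Longrightarrow> - x \<in> \<O>"
  and O_mult: "x \<in> \<O> \<Longrightarrow> y \<in> \<O> \<Longrightarrow> x * y \<in> \<O>"
  and O_add: "x \<in> \<O> \<Longrightarrow> y \<in> \<O> \<Longrightarrow> x + y \<in> \<O>"
  using O_subring(2,3,5,6,7)
  by (simp_all add: ring_of_type_algebra_simps)

lemma O_diff: "x \<in> \<O> \<Longrightarrow> y \<in> \<O> \<Longrightarrow> x - y \<in> \<O>"
  using O_add[OF _ O_neg, of x y] by simp

lemma O_of_nat: "of_nat k \<in> \<O>"
  by (induction k) (auto intro: O_zero O_one O_add)

lemma O_of_int: "of_int k \<in> \<O>"
  by (cases k rule: int_cases2) (auto intro: O_of_nat O_neg)

lemma O_power: "x \<in> \<O> \<Longrightarrow> x ^ k \<in> \<O>"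
  by (induction k) (auto intro: O_one O_mult)

lemma O_sum: "(\<And>i. i \<in> A \<Longrightarrow> f i \<in> \<O>) \<Longrightarrow> sum f A \<in> \<O>"
  by (induction A rule: infinite_finite_induct) (auto intro: O_zero O_add)

text \<open>Puts into \<open>\<O>\<close> the cofactor by which \<open>algebraic_int_dvd_int\<close>
  multiplies \<open>x\<close> to reach an integer.\<close>

lemma O_poly: "x \<in> \<O> \<Longrightarrow> poly (map_poly of_int p) x \<in> \<O>"
  by (induction p)
     (auto simp: of_int_hom.map_poly_pCons_hom intro: O_zero O_of_int O_add O_mult)

lemma w_in_O: "i \<in> {1..n} \<Longrightarrow> w i \<in> \<O>"
  using basis unfolding integral_basis_def by blast

lemma O_basis:
  assumes "x \<in> \<O>" obtains c where "x = (\<Sum>i = 1..n. of_int (c i) * w i)"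
  using basis assms unfolding integral_basis_def by meson

text \<open>Over an empty index range 1 would be an empty sum. Hence \<open>T_mat (w 1)\<close>,
  which is \<open>T_mat 1\<close>, is among the generators.\<close>

lemma n_pos: "1 \<in> {1..n}"
proof (rule ccontr)
  assume "1 \<notin> {1..n}"
  then have "{1..n} = {}"
    by auto
  moreover obtain c where "1 = (\<Sum>i = 1..n. of_int (c i) * w i)"
    using O_basis[OF O_one] .
  ultimately show False
    by simp
qed

text \<open>Pigeonhole on coordinates: modulo \<open>k\<close> there are only finitely many
  coefficient vectors, so two powers of \<open>x\<close> have congruent coordinates.\<close>

lemma finite_quotient_int:
  assumes k: "k \<noteq> 0"
  shows "finite_quotient \<O> ((*) (of_int k) ` \<O>)"
proof
  fix x y assume "x \<in> (*) (of_int k) ` \<O>" "y \<in> (*) (of_int k) ` \<O>"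
  then show "x - y \<in> (*) (of_int k) ` \<O>"
    by (auto simp: right_diff_distrib[symmetric] intro: O_diff)
next
  fix x y assume "x \<in> \<O>" "y \<in> (*) (of_int k) ` \<O>"
  then show "x * y \<in> (*) (of_int k) ` \<O>"
    by (auto simp: mult.left_commute intro!: imageI O_mult)
next
  fix x assume x: "x \<in> \<O>"
  have "\<exists>c. \<forall>j. x ^ j = (\<Sum>i = 1..n. of_int (c j i) * w i)"
  proof (intro choice allI)
    show "\<exists>c. x ^ j = (\<Sum>i = 1..n. of_int (c i) * w i)" for j
      using O_basis[OF O_power[OF x, of j]] by metis
  qed
  then obtain c where c: "\<And>j. x ^ j = (\<Sum>i = 1..n. of_int (c j i) * w i)"
    by blast
  define f where "f j = (\<lambda>i\<in>{1..n}. c j i mod k)" for j :: nat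
  \<comment> \<open>The symmetric interval contains the residues for either sign of
    \<open>k\<close>.\<close>
  have "f ` UNIV \<subseteq> {1..n} \<rightarrow>\<^sub>E {- \<bar>k\<bar>..\<bar>k\<bar>}"
  proof (intro image_subsetI)
    show "f j \<in> {1..n} \<rightarrow>\<^sub>E {- \<bar>k\<bar>..\<bar>k\<bar>}" for j
      unfolding f_def restrict_PiE_iff
      using abs_mod_less[OF k] by (metis abs_le_iff atLeastAtMost_iff less_imp_le minus_le_iff)
  qed
  then have "finite (range f)"
    by (rule finite_subset) (simp add: finite_PiE)
  then have "\<not> inj f"
    using finite_imageD infinite_UNIV_nat by blast
  then obtain i j where ij: "i < j" "f i = f j"
    unfolding inj_def by (metis linorder_neqE_nat)
  have "k dvd c i l - c j l" if "l \<in> {1..n}" for l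
    using fun_cong[OF ij(2), of l] that by (simp add: f_def mod_eq_dvd_iff)
  then have "x ^ i - x ^ j = (\<Sum>l = 1..n. of_int k * (of_int ((c i l - c j l) div k) * w l))"
    unfolding c sum_subtractf[symmetric]
    by (intro sum.cong) (simp_all add: left_diff_distrib flip: mult.assoc of_int_mult)
  also have "\<dots> = of_int k * (\<Sum>l = 1..n. of_int ((c i l - c j l) div k) * w l)"
    by (simp add: sum_distrib_left)
  finally show "\<exists>i j. i < j \<and> x ^ i - x ^ j \<in> (*) (of_int k) ` \<O>"
    using ij(1) by (blast intro: O_sum O_mult O_of_int w_in_O)
qed (auto intro: O_one O_diff O_mult O_of_int)

section \<open>The group \<open>E\<close>, its inverses and generators\<close>

interpretation SL2: group "SL2 (ring_of_integers F)"
  by (rule group_SL2) (auto intro: O_one O_diff O_mult)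

abbreviation gens :: "('a^2^2) set" where
  "gens \<equiv> insert S_mat ((\<lambda>i. T_mat (w i)) ` {1..n})"

lemma gens_in_SL2: "gens \<subseteq> carrier (SL2 (ring_of_integers F))"
  using w_in_O O_one O_zero O_neg by (auto simp: S_mat_mat2 T_mat_mat2 mat2_in_SL2_iff)

lemma subgroup_E: "subgroup (carrier E) (SL2 (ring_of_integers F))"
  using SL2.generate_is_subgroup[OF gens_in_SL2] by (simp add: elementary_group_def Let_def)

lemma E_simps: "monoid.mult E = (**)" "one E = mat2 1 0 0 1"
  by (simp_all add: elementary_group_def Let_def SL2_simps)

lemma E_group: "group E"
  using subgroup.subgroup_is_group[OF subgroup_E SL2.group_axioms]
  by (simp add: elementary_group_def Let_def)

sublocale E: group E
  by (rule E_group)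

lemma E_carrierD:
  assumes "mat2 a b c d \<in> carrier E"
  shows "a \<in> \<O>" "b \<in> \<O>" "c \<in> \<O>" "d \<in> \<O>" "a * d - b * c = 1"
  using subgroup.mem_carrier[OF subgroup_E assms] by (auto simp: mat2_in_SL2_iff)

lemma E_mult: "A \<in> carrier E \<Longrightarrow> B \<in> carrier E \<Longrightarrow> A ** B \<in> carrier E"
  using E.m_closed by (simp add: E_simps)

text \<open>The adjugate is not known beforehand to lie in \<open>E\<close>. The group inverse is
  therefore multiplied by the product of the matrix and its adjugate, which is the identity, and
  reassociated.\<close>

lemma E_inv:
  assumes "mat2 a b c d \<in> carrier E"
  shows "inv\<^bsub>E\<^esub> (mat2 a b c d) = mat2 d (- b) (- c) a"
proof -
  obtain a' b' c' d' where inv: "inv\<^bsub>E\<^esub> (mat2 a b c d) = mat2 a' b' c' d'"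
    by (rule mat2_cases)
  have "mat2 a' b' c' d' = mat2 a' b' c' d' ** (mat2 a b c d ** mat2 d (- b) (- c) a)"
    using E_carrierD(5)[OF assms] by (simp add: mat2_mult algebra_simps)
  also have "\<dots> = mat2 1 0 0 1 ** mat2 d (- b) (- c) a"
    using E.l_inv[OF assms] by (simp add: matrix_mul_assoc inv E_simps)
  finally show ?thesis
    by (simp add: inv mat2_mult)
qed

lemma S_in_E: "mat2 0 1 (- 1) 0 \<in> carrier E"
  by (auto simp: elementary_group_def Let_def S_mat_mat2[symmetric] intro: generate.incl)

lemma T_in_E: "mat2 1 1 0 1 \<in> carrier E"
proof -
  have "T_mat (w 1) \<in> carrier E"
    using n_pos unfolding elementary_group_def Let_def by (auto intro!: generate.incl)
  then show ?thesis by (simp only: w1 T_mat_mat2)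
qed

section \<open>Elementary matrices in the level closure and approximation by them\<close>

context
  fixes m :: nat
begin

abbreviation Q :: "('a^2^2) set" where "Q \<equiv> level_closure F n w m"
abbreviation mO :: "'a set" where "mO \<equiv> (*) (of_nat m) ` \<O>"

lemma Q_mult: "A \<in> Q \<Longrightarrow> B \<in> Q \<Longrightarrow> A ** B \<in> Q"
  using normal_closure_mult[of A E] by (simp add: level_closure_def Let_def E_simps)

lemma Q_one: "mat2 1 0 0 1 \<in> Q"
  using normal_closure_one[of E] by (simp add: level_closure_def Let_def E_simps)

lemma Q_conj: "g \<in> carrier E \<Longrightarrow> A \<in> Q \<Longrightarrow> g ** A ** inv\<^bsub>E\<^esub> g \<in> Q"
  using normal_closure_conj[of g E A] by (simp add: level_closure_def Let_def E_simps)

lemma Q_inv: "A \<in> Q \<Longrightarrow> inv\<^bsub>E\<^esub> A \<in> Q"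
  using normal_closure_inv[of A E] by (simp add: level_closure_def Let_def)

text \<open>Powers of a generator, with an inverse for negative \<open>k\<close>. Membership in
  \<open>E\<close> is what allows \<open>E_inv\<close> to compute inverses of such matrices.\<close>

lemma T_w_in_E: "mat2 1 (of_int k * w i) 0 1 \<in> carrier E" if "i \<in> {1..n}"
proof -
  have T: "mat2 1 (w i) 0 1 \<in> carrier E"
    using that by (auto simp: elementary_group_def Let_def T_mat_mat2 intro!: generate.incl)
  have pos: "mat2 1 (of_nat l * w i) 0 1 \<in> carrier E" for l
  proof (induction l)
    case 0
    then show ?case using E.one_closed by (simp add: E_simps)
  next
    case (Suc l)
    then show ?case using E_mult[OF Suc T] by (simp add: mat2_mult algebra_simps)
  qed
  show ?thesis
  proof (cases k rule: int_cases2)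
    case (nonneg l)
    then show ?thesis using pos by simp
  next
    case (nonpos l)
    then show ?thesis using E.inv_closed[OF pos[of l]] by (simp add: E_inv[OF pos])
  qed
qed

text \<open>As \<open>T_mat\<close> turns sums into products, closure under natural multiples,
  negation and finite sums leads from the \<open>m * w i\<close> to all of
  \<open>mO\<close>.\<close>

lemma T_in_Q:
  assumes "x \<in> mO" shows "mat2 1 x 0 1 \<in> Q"
proof -
  have w: "mat2 1 (of_nat m * w i) 0 1 \<in> Q" if "i \<in> {1..n}" for i
    using that unfolding level_closure_def Let_def T_mat_mat2
    by (auto intro!: normal_closure_base generate.incl)
  have wE: "mat2 1 (of_nat m * (of_nat l * w i)) 0 1 \<in> carrier E" if "i \<in> {1..n}" for i l
    using T_w_in_E[OF that, of "int m * int l"] by (simp add: mult.assoc)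
  have nat: "mat2 1 (of_nat m * (of_nat l * w i)) 0 1 \<in> Q" if "i \<in> {1..n}" for l i
  proof (induction l)
    case 0
    then show ?case by (simp add: Q_one)
  next
    case (Suc l)
    then show ?case using Q_mult[OF Suc w[OF that]] by (simp add: mat2_mult algebra_simps)
  qed
  have int: "mat2 1 (of_nat m * (of_int k * w i)) 0 1 \<in> Q" if "i \<in> {1..n}" for k i
  proof (cases k rule: int_cases2)
    case (nonneg l)
    then show ?thesis using nat[OF that] by simp
  next
    case (nonpos l)
    then show ?thesis using Q_inv[OF nat[OF that, of l]] by (simp add: E_inv[OF wE[OF that]])
  qed
  obtain y where y: "y \<in> \<O>" "x = of_nat m * y"
    using assms by blast
  obtain c where c: "y = (\<Sum>i = 1..n. of_int (c i) * w i)"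
    using O_basis[OF y(1)] .
  have "mat2 1 (of_nat m * (\<Sum>i\<in>A. of_int (c i) * w i)) 0 1 \<in> Q"
    if "finite A" "A \<subseteq> {1..n}" for A
    using that
  proof (induction A)
    case empty
    then show ?case by (simp add: Q_one)
  next
    case (insert i A)
    then have "mat2 1 (of_nat m * (of_int (c i) * w i)) 0 1 **
        mat2 1 (of_nat m * (\<Sum>i\<in>A. of_int (c i) * w i)) 0 1 \<in> Q"
      using int by (intro Q_mult) auto
    then show ?case
      using insert by (simp add: mat2_mult algebra_simps)
  qed
  then show ?thesis
    unfolding y(2) c by blast
qed

lemma mO_neg: "x \<in> mO \<Longrightarrow> - x \<in> mO"
  by (auto intro!: image_eqI[where x = "- y" for y] O_neg)

lemma mO_add: "x \<in> mO \<Longrightarrow> y \<in> mO \<Longrightarrow> x + y \<in> mO"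
  by (auto intro!: image_eqI[where x = "y + z" for y z] O_add simp: distrib_left)

lemma mO_mult: "r \<in> \<O> \<Longrightarrow> x \<in> mO \<Longrightarrow> r * x \<in> mO"
  by (auto simp: mult.left_commute intro!: imageI O_mult)

text \<open>Conjugation by \<open>S_mat\<close> exchanges upper and lower elementary matrices, up to
  sign.\<close>

lemma L_in_Q:
  assumes "x \<in> mO" shows "mat2 1 0 x 1 \<in> Q"
proof -
  have "mat2 0 1 (- 1) 0 ** mat2 1 (- x) 0 1 ** inv\<^bsub>E\<^esub> (mat2 0 1 (- 1) 0) \<in> Q"
    using assms by (intro Q_conj S_in_E T_in_Q mO_neg)
  then show ?thesis
    by (simp add: E_inv[OF S_in_E] mat2_mult)
qed

text \<open>A lower elementary matrix conjugated by \<open>T_mat (- 1)\<close>. It realises any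
  upper left entry congruent to 1 modulo \<open>m\<close>.\<close>

lemma conjugate_in_Q:
  assumes "z \<in> mO" shows "mat2 (1 + z) z (- z) (1 - z) \<in> Q"
proof -
  have E: "mat2 1 (- 1) 0 1 \<in> carrier E"
    using E.inv_closed[OF T_in_E] by (simp add: E_inv[OF T_in_E])
  have "mat2 1 (- 1) 0 1 ** mat2 1 0 (- z) 1 ** inv\<^bsub>E\<^esub> (mat2 1 (- 1) 0 1) \<in> Q"
    using assms by (intro Q_conj E L_in_Q mO_neg)
  then show ?thesis
    by (simp add: E_inv[OF E] mat2_mult)
qed

lemma Q_approximation:
  assumes k: "k \<noteq> 0" and A: "mat2 a b c d \<in> carrier E"
    and "a - 1 \<in> mO" "b \<in> mO" "c \<in> mO" "d - 1 \<in> mO"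
  defines "J \<equiv> (*) (of_int k) ` \<O>"
  obtains a' b' c' d' where "mat2 a' b' c' d' \<in> Q"
    "a - a' \<in> J" "b - b' \<in> J" "c - c' \<in> J" "d - d' \<in> J"
proof -
  interpret finite_quotient \<O> J
    unfolding J_def by (rule finite_quotient_int[OF k])
  note entries = E_carrierD[OF A]
  have mO_O: "mO \<subseteq> \<O>"
    by (auto intro: O_mult O_of_nat)
  obtain a1 where a1: "a1 \<in> \<O>" "a = 1 + of_nat m * a1"
    using \<open>a - 1 \<in> mO\<close> by (auto simp: algebra_simps)
  have mb: "of_nat m * b \<in> \<O>" "a * d - of_nat m * a1 * d - b * c \<in> \<O>" "a1 * c \<in> \<O>"
    using entries a1 O_mult O_diff O_of_nat by simp_all
  \<comment> \<open>The product of the relations \<open>a - m * a1 = 1\<close> and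
    \<open>a * d - b * c = 1\<close> shows that \<open>a\<close> and \<open>m * b\<close> are
    unimodular. Using \<open>m * b\<close> in place of \<open>b\<close> makes the multiplier
    \<open>p = t * m\<close> lie in \<open>mO\<close>.\<close>
  have "a * (a * d - of_nat m * a1 * d - b * c) + of_nat m * b * (a1 * c) - 1 =
      (a - of_nat m * a1) * (a * d - b * c) - 1"
    by (simp add: algebra_simps)
  also have "\<dots> = 0"
    using entries(5) a1(2) by simp
  finally have "a * (a * d - of_nat m * a1 * d - b * c) + of_nat m * b * (a1 * c) - 1 \<in> J"
    using ideal_zero by simp
  then obtain t s where t: "t \<in> \<O>" and s: "s \<in> \<O>" "(a + t * (of_nat m * b)) * s - 1 \<in> J"
    using stable_range[OF entries(1) mb] by blast
  define p where "p = t * of_nat m"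
  \<comment> \<open>The first column of the given matrix times \<open>mat2 1 0 p 1\<close> is
    \<open>u\<close>, \<open>v\<close>; modulo \<open>J\<close>, \<open>u\<close> has inverse
    \<open>s\<close>.\<close>
  define u where "u = a + p * b"
  define v where "v = c + p * d"
  define z where "z = u - 1"
  \<comment> \<open>Chosen so that \<open>u * x - z\<close> is \<open>v\<close> and
    \<open>u * y + z\<close> is \<open>b\<close> modulo \<open>J\<close>.\<close>
  define x where "x = s * (v + z)"
  define y where "y = s * (b - z)"
  have us: "u * s - 1 \<in> J"
    using s(2) by (simp add: u_def p_def mult.assoc)
  have p: "p \<in> mO"
    using t by (metis p_def imageI mult.commute)
  have u: "u \<in> \<O>" and pd: "p * d \<in> mO" and pb: "p * b \<in> mO"
    using p entries mO_O mO_mult[of d p] mO_mult[of b p]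
    by (auto simp: u_def mult.commute intro: O_add O_mult)
  have v: "v \<in> mO" and z: "z \<in> mO"
    using mO_add[OF \<open>c \<in> mO\<close> pd] mO_add[OF \<open>a - 1 \<in> mO\<close> pb]
    by (simp_all add: v_def z_def u_def algebra_simps)
  have x: "x \<in> mO"
    using s v z by (simp add: x_def mO_mult mO_add)
  have y: "y \<in> mO"
    using mO_mult[OF s(1) mO_add[OF \<open>b \<in> mO\<close> mO_neg[OF z]]] by (simp add: y_def)
  have in_O: "x \<in> \<O>" "y \<in> \<O>" "z \<in> \<O>" "v \<in> \<O>" "p \<in> \<O>"
    using x y z v p mO_O by blast+
  \<comment> \<open>The outer factors change the off-diagonal entries but keep the upper left entry
    \<open>1 + z = u\<close>.\<close>
  define B where "B = mat2 1 0 x 1 ** mat2 (1 + z) z (- z) (1 - z) ** mat2 1 y 0 1"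
  have B: "B \<in> Q"
    unfolding B_def by (intro Q_mult L_in_Q T_in_Q conjugate_in_Q x y z)
  define b1 where "b1 = u * y + z"
  define c1 where "c1 = u * x - z"
  define d1 where "d1 = c1 * y + x * z + 1 - z"
  have B_eq: "B = mat2 u b1 c1 d1"
    by (simp add: B_def mat2_mult z_def b1_def c1_def d1_def algebra_simps)
  have det1: "u * d1 - b1 * c1 = 1"
    by (simp add: b1_def c1_def d1_def z_def algebra_simps)
  have det: "u * d - b * v = 1"
    using entries(5) by (simp add: u_def v_def algebra_simps)
  have in_O1: "b1 \<in> \<O>" "c1 \<in> \<O>" "d1 \<in> \<O>"
    using in_O u O_one by (simp_all add: b1_def c1_def d1_def O_add O_diff O_mult)
  have bb: "b - b1 \<in> J"
  proof -
    have "b - b1 = - ((u * s - 1) * (b - z))"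
      by (simp add: b1_def y_def algebra_simps)
    then show ?thesis
      by (simp only:) (intro ideal_neg ideal_mult_right us O_diff entries in_O)
  qed
  have vc: "v - c1 \<in> J"
  proof -
    have "v - c1 = - ((u * s - 1) * (v + z))"
      by (simp add: c1_def x_def algebra_simps)
    then show ?thesis
      by (simp only:) (intro ideal_neg ideal_mult_right us O_add entries in_O)
  qed
  have dd: "d - d1 \<in> J"
  proof -
    \<comment> \<open>With both determinants 1, the other three entries determine the last one
      modulo \<open>J\<close>, because \<open>u\<close> is a unit there.\<close>
    have "u * (d - d1) = b * v - b1 * c1"
      using det det1 by (simp add: algebra_simps)
    also have "\<dots> = (b - b1) * v + b1 * (v - c1)"
      by (simp add: algebra_simps)
    finally have "s * (u * (d - d1)) - (u * s - 1) * (d - d1) \<in> J"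
      by (simp only:) (intro ideal_diff ideal_add ideal_mult ideal_mult_right us bb vc
        entries in_O in_O1 O_diff s(1))
    then show ?thesis
      by (simp add: algebra_simps)
  qed
  show ?thesis
  proof (rule that)
    \<comment> \<open>Undoes the initial multiplication by \<open>mat2 1 0 p 1\<close>.\<close>
    have "B ** mat2 1 0 (- p) 1 \<in> Q"
      by (intro Q_mult B L_in_Q mO_neg p)
    then show "mat2 (u - b1 * p) b1 (c1 - d1 * p) d1 \<in> Q"
      by (simp add: B_eq mat2_mult)
    have "- ((b - b1) * p) \<in> J"
      by (intro ideal_neg ideal_mult_right bb in_O)
    then show "a - (u - b1 * p) \<in> J"
      by (simp add: u_def algebra_simps)
    have "(v - c1) - (d - d1) * p \<in> J"
      by (intro ideal_diff ideal_mult_right vc dd in_O)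
    then show "c - (c1 - d1 * p) \<in> J"
      by (simp add: v_def algebra_simps)
  qed (fact bb dd)+
qed

text \<open>The intersection defining the hull lies in \<open>carrier E\<close> because
  \<open>carrier E\<close> is itself a normal subgroup containing the generators.\<close>

lemma Q_subset_E: "Q \<subseteq> carrier E"
proof
  fix A assume A: "A \<in> Q"
  have "T_mat (of_nat m * w i) \<in> carrier E" if "i \<in> {1..n}" for i
    using T_w_in_E[OF that, of "int m"] by (simp add: T_mat_mat2)
  then have "generate E ((\<lambda>i. T_mat (of_nat m * w i)) ` {1..n}) \<subseteq> carrier E"
    by (intro E.generate_incl) auto
  moreover have "carrier E \<lhd> E"
    by (rule E.normal_invI) (auto intro: E.subgroup_self)
  ultimately show "A \<in> carrier E"
    using A normal_closureD[of A E] by (simp add: level_closure_def Let_def)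
qed

section \<open>Congruence subgroups and the level\<close>

lemma PIdl_of_nat: "PIdl\<^bsub>ring_of_integers F\<^esub> (of_nat m) = mO"
  by (auto simp: cgenideal_def ring_of_integers_simps mult.commute image_iff)

lemma principal_congruence_subset_if_congruence:
  assumes K: "congruence_subgroup F n w K" and Q: "Q \<subseteq> K"
  shows "principal_congruence F n w mO \<subseteq> K"
proof
  fix A assume A: "A \<in> principal_congruence F n w mO"
  obtain a b c d where A_eq: "A = mat2 a b c d"
    by (rule mat2_cases)
  have AE: "mat2 a b c d \<in> carrier E"
    and AmO: "a - 1 \<in> mO" "b \<in> mO" "c \<in> mO" "d - 1 \<in> mO"
    using A by (auto simp: A_eq principal_congruence_def)
  obtain I where I: "ideal I (ring_of_integers F)" "I \<noteq> {0}" "principal_congruence F n w I \<subseteq> K"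
    and sub: "subgroup K E"
    using K unfolding congruence_subgroup_def by blast
  interpret I: ideal I "ring_of_integers F"
    by (rule I(1))
  \<comment> \<open>Since 0 lies in \<open>I\<close>, the condition \<open>I \<noteq> {0}\<close>
    yields a nonzero element.\<close>
  have "0 \<in> I"
    using I.additive_subgroup_axioms additive_subgroup.zero_closed
    by (fastforce simp: ring_of_integers_simps)
  then obtain x where x: "x \<in> I" "x \<noteq> 0"
    using I(2) by blast
  then have xO: "x \<in> \<O>"
    using I.a_subset by blast
  then obtain q k where k: "k \<noteq> 0" "of_int k = poly (map_poly of_int q) x * x"
    using x(2) by (auto simp: ring_of_integers_simps elim: algebraic_int_dvd_int)
  have I_mult: "y * r \<in> I" if "r \<in> I" "y \<in> \<O>" for r y
    using I.I_l_closed[OF that] by (simp add: ring_of_integers_simps)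
  have "of_int k \<in> I"
    using I_mult[OF x(1) O_poly[OF xO]] by (simp add: k(2))
  define J where "J = (*) (of_int k) ` \<O>"
  have JI: "J \<subseteq> I"
    using I_mult[OF \<open>of_int k \<in> I\<close>] by (auto simp: J_def mult.commute)
  interpret finite_quotient \<O> J
    unfolding J_def by (rule finite_quotient_int[OF k(1)])
  obtain a' b' c' d' where B: "mat2 a' b' c' d' \<in> Q"
    and J: "a - a' \<in> J" "b - b' \<in> J" "c - c' \<in> J" "d - d' \<in> J"
    using Q_approximation[OF k(1) AE AmO] unfolding J_def by blast
  have BE: "mat2 a' b' c' d' \<in> carrier E"
    using B Q_subset_E by blast
  note entries = E_carrierD[OF BE]
  let ?B = "mat2 a' b' c' d'" and ?B' = "mat2 d' (- b') (- c') a'"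
  have BB': "inv\<^bsub>E\<^esub> ?B = ?B'"
    by (rule E_inv[OF BE])
  have "?B' ** mat2 a b c d \<in> principal_congruence F n w J"
  proof -
    have "?B' ** mat2 a b c d \<in> carrier E"
      using E_mult[OF E.inv_closed[OF BE] AE] by (simp only: BB')
    \<comment> \<open>These are the entries of \<open>?B'\<close> times the difference of the two
      matrices, that is, of the product \<open>?B' ** mat2 a b c d\<close> minus the
      identity.\<close>
    moreover have "d' * (a - a') - b' * (c - c') \<in> J" "d' * (b - b') - b' * (d - d') \<in> J"
      "a' * (c - c') - c' * (a - a') \<in> J" "a' * (d - d') - c' * (b - b') \<in> J"
      by (intro ideal_diff ideal_mult J entries)+
    moreover have "d' * (a - a') - b' * (c - c') = d' * a + - b' * c - 1"
      "a' * (d - d') - c' * (b - b') = - c' * b + a' * d - 1"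
      using entries(5) by (simp_all add: algebra_simps)
    moreover have "d' * (b - b') - b' * (d - d') = d' * b + - b' * d"
      "a' * (c - c') - c' * (a - a') = - c' * a + a' * c"
      by (simp_all add: algebra_simps)
    ultimately show ?thesis
      unfolding principal_congruence_def by (simp add: mat2_mult)
  qed
  then have "?B' ** mat2 a b c d \<in> K"
    using I(3) JI unfolding principal_congruence_def by blast
  then have "?B ** (?B' ** mat2 a b c d) \<in> K"
    using subgroup.m_closed[OF sub, of ?B] B Q by (auto simp: E_simps)
  moreover have "?B ** (?B' ** mat2 a b c d) = A"
    using entries(5) by (simp add: matrix_mul_assoc A_eq) (simp add: mat2_mult algebra_simps)
  ultimately show "A \<in> K"
    by simp
qed

end

end

theorem theorem3p2:
  fixes F :: "'a::field_char_0 set"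
    and n :: nat and w :: "nat \<Rightarrow> 'a"
    and K :: "('a^2^2) set" and m :: nat
  assumes "number_field F"
    and "integral_basis F n w" and "w 1 = 1"
    and "subgroup K (elementary_group F n w)"
    and "finite_index (elementary_group F n w) K"
    and "has_level F n w K m"
  shows "congruence_subgroup F n w K \<longleftrightarrow>
         principal_congruence F n w (PIdl\<^bsub>ring_of_integers F\<^esub> (of_nat m)) \<subseteq> K"
proof -
  interpret number_field_basis F n w
    by (rule number_field_basis.intro) fact+
  have m: "m > 0" "level_closure F n w m \<subseteq> K"
    using assms(6) by (auto simp: has_level_def)
  show ?thesis
  proof
    assume "congruence_subgroup F n w K"
    then show "principal_congruence F n w (PIdl\<^bsub>ring_of_integers F\<^esub> (of_nat m)) \<subseteq> K"
      unfolding PIdl_of_nat using m(2) by (rule principal_congruence_subset_if_congruence)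
  next
    assume "principal_congruence F n w (PIdl\<^bsub>ring_of_integers F\<^esub> (of_nat m)) \<subseteq> K"
    moreover have "ideal (PIdl\<^bsub>ring_of_integers F\<^esub> (of_nat m)) (ring_of_integers F)"
      by (rule cring.cgenideal_ideal[OF cring_ring_of_integers[OF assms(1)] O_of_nat])
    \<comment> \<open>The ideal \<open>mO\<close> itself witnesses congruence; \<open>m\<close> is a
      nonzero element of it in characteristic 0.\<close>
    moreover have "of_nat m * 1 \<in> PIdl\<^bsub>ring_of_integers F\<^esub> (of_nat m)"
      unfolding PIdl_of_nat by (intro imageI O_one)
    then have "PIdl\<^bsub>ring_of_integers F\<^esub> (of_nat m) \<noteq> {0}"
      using m(1) by auto
    ultimately show "congruence_subgroup F n w K"
      using assms(4) unfolding congruence_subgroup_def by blast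
  qed
qed

end
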